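(* Let $G$ be a finite simple bipartite graph without isolated vertices. Then the following are equivalent: (a) every connected component of $G$ is either a star or $2$-internally extendable; (b) every $2$-matching of $G$ extends to a perfect internal matching of $G$; (c) $G$ is strongly equistarable; (d) $G$ is equistarable.
   Context: A star is a graph isomorphic to $K_{1,n}$ for some $n\ge 1$. A matching is a set of pairwise disjoint edges; a $k$-matching is a matching with exactly $k$ edges. A matching $M$ extends to a matching $M'$ if $M\subseteq M'$. A matching $M$ of $G$ is a perfect internal matching if every vertex not covered by $M$ is a leaf (a vertex of degree $1$). For $k\ge 1$, a connected graph $G$ is $k$-internally extendable if $G$ contains a $k$-matching and every $k$-matching of $G$ extends to a perfect internal matching. For a vertex $v$, the star rooted at $v$ is the set $E(v)$ of all edges incident with $v$; a star of $G$ is a set $E(v)$ for some vertex $v$, and it is maximal if it is not properly contained in any other star of $G$. A graph $G=(V,E)$ without isolated vertices is equistarable if there is a mapping $\varphi:E\to\mathbb{R}_+$ such that for every $F\subseteq E$, $F$ is a maximal star of $G$ if and only if $\sum_{e\in F}\varphi(e)=1$. Let $\mathcal{S}^*(G)$ be the set of maximal stars of $G$ and $\mathcal{T}^*(G)$ the set of all other nonempty subsets of $E$. A graph $G$ without isolated vertices is strongly equistarable if for each $T\in\mathcal{T}^*(G)$ and each $\gamma\le 1$ there exists $\varphi:E\to\mathbb{R}_+$ with $\varphi(S)=1$ for all $S\in\mathcal{S}^*(G)$ and $\varphi(T)\neq\gamma$, where $\varphi(X)=\sum_{e\in X}\varphi(e)$. *)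

theory Defs
  imports Complex_Main
begin

datatype 'a ugraph = UGraph (uverts: "'a set") (uedges: "'a set set")

definition finite_simple_graph :: "'a ugraph \<Rightarrow> bool" where
  "finite_simple_graph G \<longleftrightarrow>
     finite (uverts G) \<and> (\<forall>e\<in>uedges G. e \<subseteq> uverts G \<and> card e = 2)"

definition rooted_star :: "'a ugraph \<Rightarrow> 'a \<Rightarrow> 'a set set" where
  "rooted_star G v = {e \<in> uedges G. v \<in> e}"

definition udegree :: "'a ugraph \<Rightarrow> 'a \<Rightarrow> nat" where
  "udegree G v = card (rooted_star G v)"

definition no_isolated_vertices :: "'a ugraph \<Rightarrow> bool" where
  "no_isolated_vertices G \<longleftrightarrow> (\<forall>v\<in>uverts G. rooted_star G v \<noteq> {})"

definition bipartite_graph :: "'a ugraph \<Rightarrow> bool" where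
  "bipartite_graph G \<longleftrightarrow>
     (\<exists>A B. A \<union> B = uverts G \<and> A \<inter> B = {} \<and> (\<forall>e\<in>uedges G. \<exists>a\<in>A. \<exists>b\<in>B. e = {a, b}))"

definition graph_reachable :: "'a ugraph \<Rightarrow> 'a \<Rightarrow> 'a \<Rightarrow> bool" where
  "graph_reachable G u v \<longleftrightarrow> (u, v) \<in> {(x, y). {x, y} \<in> uedges G}\<^sup>*"

definition connected_graph :: "'a ugraph \<Rightarrow> bool" where
  "connected_graph G \<longleftrightarrow>
     uverts G \<noteq> {} \<and> (\<forall>u\<in>uverts G. \<forall>v\<in>uverts G. graph_reachable G u v)"

definition induced_graph :: "'a ugraph \<Rightarrow> 'a set \<Rightarrow> 'a ugraph" where
  "induced_graph G W = UGraph W {e \<in> uedges G. e \<subseteq> W}"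

definition graph_components :: "'a ugraph \<Rightarrow> 'a ugraph set" where
  "graph_components G = {induced_graph G {v \<in> uverts G. graph_reachable G u v} | u. u \<in> uverts G}"

definition graph_isomorphic :: "'a ugraph \<Rightarrow> 'b ugraph \<Rightarrow> bool" where
  "graph_isomorphic G H \<longleftrightarrow>
     (\<exists>f. bij_betw f (uverts G) (uverts H) \<and>
          (\<forall>u\<in>uverts G. \<forall>v\<in>uverts G. {u, v} \<in> uedges G \<longleftrightarrow> {f u, f v} \<in> uedges H))"

text \<open>The graph \<open>K\<^bsub>1,n\<^esub>\<close>, with centre \<open>0\<close>.\<close>

definition complete_bipartite_1 :: "nat \<Rightarrow> nat ugraph" where
  "complete_bipartite_1 n = UGraph {0..n} {{0, i} | i. i \<in> {1..n}}"

definition star_graph :: "'a ugraph \<Rightarrow> bool" where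
  "star_graph G \<longleftrightarrow> (\<exists>n\<ge>1. graph_isomorphic G (complete_bipartite_1 n))"

definition graph_matching :: "'a ugraph \<Rightarrow> 'a set set \<Rightarrow> bool" where
  "graph_matching G M \<longleftrightarrow> M \<subseteq> uedges G \<and> pairwise disjnt M"

definition k_matching :: "'a ugraph \<Rightarrow> nat \<Rightarrow> 'a set set \<Rightarrow> bool" where
  "k_matching G k M \<longleftrightarrow> graph_matching G M \<and> finite M \<and> card M = k"

definition perfect_internal_matching :: "'a ugraph \<Rightarrow> 'a set set \<Rightarrow> bool" where
  "perfect_internal_matching G M \<longleftrightarrow>
     graph_matching G M \<and> (\<forall>v\<in>uverts G - \<Union>M. udegree G v = 1)"

definition extends_to_perfect_internal :: "'a ugraph \<Rightarrow> 'a set set \<Rightarrow> bool" where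
  "extends_to_perfect_internal G M \<longleftrightarrow> (\<exists>M'. perfect_internal_matching G M' \<and> M \<subseteq> M')"

definition internally_extendable :: "nat \<Rightarrow> 'a ugraph \<Rightarrow> bool" where
  "internally_extendable k G \<longleftrightarrow>
     connected_graph G \<and> (\<exists>M. k_matching G k M) \<and>
     (\<forall>M. k_matching G k M \<longrightarrow> extends_to_perfect_internal G M)"

definition edge_stars :: "'a ugraph \<Rightarrow> 'a set set set" where
  "edge_stars G = {rooted_star G v | v. v \<in> uverts G}"

definition maximal_stars :: "'a ugraph \<Rightarrow> 'a set set set" where
  "maximal_stars G = {S \<in> edge_stars G. \<not> (\<exists>S'\<in>edge_stars G. S \<subset> S')}"

definition nonmaximal_star_sets :: "'a ugraph \<Rightarrow> 'a set set set" where
  "nonmaximal_star_sets G = {T. T \<subseteq> uedges G \<and> T \<noteq> {} \<and> T \<notin> maximal_stars G}"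

text \<open>Edge weights are nonnegative reals, with zero allowed; they are total functions of which
  only the values on the edges matter.\<close>

definition equistarable :: "'a ugraph \<Rightarrow> bool" where
  "equistarable G \<longleftrightarrow>
     no_isolated_vertices G \<and>
     (\<exists>\<phi> :: 'a set \<Rightarrow> real. (\<forall>e\<in>uedges G. \<phi> e \<ge> 0) \<and>
        (\<forall>F\<subseteq>uedges G. F \<in> maximal_stars G \<longleftrightarrow> (\<Sum>e\<in>F. \<phi> e) = 1))"

definition strongly_equistarable :: "'a ugraph \<Rightarrow> bool" where
  "strongly_equistarable G \<longleftrightarrow>
     no_isolated_vertices G \<and>
     (\<forall>T\<in>nonmaximal_star_sets G. \<forall>\<gamma>::real. \<gamma> \<le> 1 \<longrightarrow>
        (\<exists>\<phi> :: 'a set \<Rightarrow> real. (\<forall>e\<in>uedges G. \<phi> e \<ge> 0) \<and>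
           (\<forall>S\<in>maximal_stars G. (\<Sum>e\<in>S. \<phi> e) = 1) \<and> (\<Sum>e\<in>T. \<phi> e) \<noteq> \<gamma>))"

end

theory Submission
  imports Defs
begin

text \<open>
  Stars and pairs of disjoint edges are complementary: in a bipartite graph a nonempty set of pairwise
  intersecting edges lies in a star. If all 2-matchings extend, the indicator functions of perfect
  internal matchings (together with the isolated edges) already separate every other edge set from
  the maximal stars. Conversely, an equistarability weight \<open>\<phi>\<close> is positive on edges; if a 2-matching
  did not extend, Hall's condition would fail on one side of the remaining graph, and the failure is
  only possible when some set of edges containing the 2-matching has \<open>\<phi>\<close>-weight exactly \<open>1\<close>.
  Strong equistarability gives equistarability since finitely many proper affine sections do not
  exhaust a convex set.
\<close>

section \<open>Systems of distinct representatives\<close>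

text \<open>The star of a leaf may lie properly inside the star of its neighbour and then weighs
  less than 1, so counting vertices by star weights is exact only for sets of internal vertices.
  This is why leaves among the neighbours of a Hall violator X have to be excluded. The value 1 is
  squeezed from both sides. Deleting the ends of the two given edges removes at most two vertices
  from N(X), so a violation gives |N(X)| - |X| \<le> 1. On the other hand |N(X)| - |X| is the weight
  of an edge set that turns out to contain one of the given edges, so it is positive. Hall's
  condition on one side covers only the internal vertices of that side, with partners that may be
  leaves or internal. The two one-sided matchings can therefore conflict and have to be merged
  rather than united. In the passage between (a) and (b) the difficulty is a 2-matching whose edges
  lie in different components: single edges must then extend as well.\<close>

lemma hall_marriage:
  fixes S :: "'i \<Rightarrow> 'b set"
  assumes "finite J" and "\<And>x. x \<in> J \<Longrightarrow> finite (S x)"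
    and "\<And>X. X \<subseteq> J \<Longrightarrow> card X \<le> card (\<Union>(S ` X))"
  shows "\<exists>f. inj_on f J \<and> (\<forall>x\<in>J. f x \<in> S x)"
  using assms
proof (induction "card J" arbitrary: J S rule: less_induct)
  case less
  note fin = less.prems(1,2) and hall = less.prems(3)
  show ?case
  proof (cases "\<exists>X. X \<subset> J \<and> X \<noteq> {} \<and> card (\<Union>(S ` X)) = card X")
    case True
    then obtain X where X: "X \<subset> J" "X \<noteq> {}" "card (\<Union>(S ` X)) = card X" by blast
    let ?U = "\<Union>(S ` X)"
    have finX: "finite X" using X(1) fin(1) finite_subset by blast
    have "card X < card J" using X(1) fin(1) by (rule psubset_card_mono[rotated])
    then have "\<exists>f. inj_on f X \<and> (\<forall>x\<in>X. f x \<in> S x)"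
      using X(1) fin hall finX by (intro less.hyps) auto
    then obtain f where f: "inj_on f X" "\<forall>x\<in>X. f x \<in> S x" by blast
    have "card (J - X) < card J"
      using X fin(1) by (intro psubset_card_mono) auto
    \<comment> \<open>The tight set \<open>X\<close> uses up all of \<open>?U\<close>, so a shortage
      of values for \<open>Y\<close> outside \<open>?U\<close> would be a shortage for
      \<open>X \<union> Y\<close> in the original family.\<close>
    moreover have "card Y \<le> card (\<Union>((\<lambda>x. S x - ?U) ` Y))" if Y: "Y \<subseteq> J - X" for Y
    proof -
      have YX: "Y \<subseteq> J" "Y \<inter> X = {}" using Y by auto
      have finY: "finite Y" using YX(1) fin(1) finite_subset by blast
      have eq: "\<Union>(S ` (X \<union> Y)) = ?U \<union> \<Union>((\<lambda>x. S x - ?U) ` Y)" by auto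
      have "card X + card Y = card (X \<union> Y)"
        using YX finX finY by (subst card_Un_disjoint) auto
      also have "\<dots> \<le> card (\<Union>(S ` (X \<union> Y)))" using X YX by (intro hall) auto
      also have "\<dots> \<le> card ?U + card (\<Union>((\<lambda>x. S x - ?U) ` Y))"
        unfolding eq by (rule card_Un_le)
      finally show ?thesis using X(3) by simp
    qed
    ultimately have "\<exists>g. inj_on g (J - X) \<and> (\<forall>x\<in>J - X. g x \<in> S x - ?U)"
      using fin by (intro less.hyps) auto
    then obtain g where g: "inj_on g (J - X)" "\<forall>x\<in>J - X. g x \<in> S x - ?U" by blast
    let ?h = "\<lambda>x. if x \<in> X then f x else g x"
    have "inj_on ?h J"
      using f g X(1) unfolding inj_on_def by (smt (verit) DiffD2 DiffI UN_I)
    moreover have "\<forall>x\<in>J. ?h x \<in> S x" using f(2) g(2) by auto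
    ultimately show ?thesis by blast
  next
    case False
    show ?thesis
    proof (cases "J = {}")
      case False
      then obtain x where x: "x \<in> J" by blast
      have "S x \<noteq> {}" using hall[of "{x}"] x by auto
      then obtain y where y: "y \<in> S x" by blast
      \<comment> \<open>No nonempty proper subset of \<open>J\<close> is tight in this case, so each
        one has a spare value and can afford to lose \<open>y\<close>.\<close>
      have "card X \<le> card (\<Union>((\<lambda>z. S z - {y}) ` X))" if X: "X \<subseteq> J - {x}" for X
      proof (cases "X = {}")
        case False
        have "X \<subset> J" using X x by auto
        then have "card X < card (\<Union>(S ` X))"
          using hall[of X] \<open>\<not> (\<exists>X. _ X)\<close> False by (metis order_le_less psubset_imp_subset)
        moreover have "\<Union>((\<lambda>z. S z - {y}) ` X) = \<Union>(S ` X) - {y}" by auto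
        ultimately show ?thesis by (auto simp: card_Diff_singleton_if)
      qed auto
      moreover have "card (J - {x}) < card J" using x fin(1) by (meson card_Diff1_less)
      ultimately have "\<exists>f. inj_on f (J - {x}) \<and> (\<forall>z\<in>J - {x}. f z \<in> S z - {y})"
        using fin by (intro less.hyps) auto
      then obtain f where f: "inj_on f (J - {x})" "\<forall>z\<in>J - {x}. f z \<in> S z - {y}" by blast
      have "inj_on (f(x := y)) J" using f unfolding inj_on_def by auto
      moreover have "\<forall>z\<in>J. (f(x := y)) z \<in> S z" using f(2) y by auto
      ultimately show ?thesis by blast
    qed auto
  qed
qed

text \<open>The Mendelsohn--Dulmage theorem in Schroeder--Bernstein form: two partial matchings \<open>f\<close> and
  \<open>g\<close> in opposite directions are merged along a fixed point of \<open>P \<mapsto> J - g (K - f P)\<close>.\<close>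
lemma schroeder_bernstein_sets:
  obtains P Q where "P = J - g ` Q" and "Q = K - f ` P"
proof -
  let ?F = "\<lambda>P. J - g ` (K - f ` P)"
  have "mono ?F" by (intro monoI Diff_mono image_mono order_refl)
  from lfp_unfold[OF this] show ?thesis using that by blast
qed

section \<open>Bipartite graphs\<close>

definition pairs_extend :: "'a ugraph \<Rightarrow> bool" where
  "pairs_extend G \<longleftrightarrow> (\<forall>M. k_matching G 2 M \<longrightarrow> extends_to_perfect_internal G M)"

lemma k_matching_2_iff:
  "k_matching G 2 M \<longleftrightarrow>
    (\<exists>e f. M = {e, f} \<and> e \<noteq> f \<and> e \<in> uedges G \<and> f \<in> uedges G \<and> e \<inter> f = {})"
proof
  assume M: "k_matching G 2 M"
  then obtain e f where "M = {e, f}" "e \<noteq> f"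
    unfolding k_matching_def by (metis card_2_iff)
  then show "\<exists>e f. M = {e, f} \<and> e \<noteq> f \<and> e \<in> uedges G \<and> f \<in> uedges G \<and> e \<inter> f = {}"
    using M unfolding k_matching_def graph_matching_def by (auto simp: pairwise_def disjnt_def)
next
  assume "\<exists>e f. M = {e, f} \<and> e \<noteq> f \<and> e \<in> uedges G \<and> f \<in> uedges G \<and> e \<inter> f = {}"
  then obtain e f where "M = {e, f}" "e \<noteq> f" "e \<in> uedges G" "f \<in> uedges G" "e \<inter> f = {}"
    by blast
  moreover from this have "disjnt e f" "disjnt f e" by (auto simp: disjnt_def)
  ultimately show "k_matching G 2 M"
    unfolding k_matching_def graph_matching_def by (simp add: pairwise_insert)
qed

lemma maximal_star_subset: "S \<in> maximal_stars G \<Longrightarrow> S \<subseteq> uedges G"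
  unfolding maximal_stars_def edge_stars_def rooted_star_def by auto

text \<open>The two sides are parameters, so that one-sided results transfer to the other side by
  \<open>flip\<close> and the whole context can be instantiated for components.\<close>

locale bipartition =
  fixes G :: "'a ugraph" and A B :: "'a set"
  assumes finV: "finite (uverts G)"
    and union: "A \<union> B = uverts G" and disj: "A \<inter> B = {}"
    and edges: "\<And>e. e \<in> uedges G \<Longrightarrow> \<exists>a\<in>A. \<exists>b\<in>B. e = {a, b}"
begin

lemma edgeE:
  assumes "e \<in> uedges G"
  obtains a b where "a \<in> A" "b \<in> B" "e = {a, b}" "a \<notin> B" "b \<notin> A"
  using edges[OF assms] disj by blast

lemma flip: "bipartition G B A"
proof
  show "\<exists>b\<in>B. \<exists>a\<in>A. e = {b, a}" if "e \<in> uedges G" for e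
    using edgeE[OF that] by (metis insert_commute)
qed (use finV union disj in \<open>simp_all add: Un_commute Int_commute\<close>)

lemma finA: "finite A" and finB: "finite B"
  using finV union by (metis finite_Un)+

lemma edge_subset: "e \<in> uedges G \<Longrightarrow> e \<subseteq> uverts G"
  using union by (auto elim: edgeE)

lemma finE: "finite (uedges G)"
proof (rule finite_subset)
  show "uedges G \<subseteq> Pow (uverts G)" using edge_subset by blast
  show "finite (Pow (uverts G))" using finV by simp
qed

lemma fin_star: "finite (rooted_star G v)"
  using finE unfolding rooted_star_def by auto

lemma edge_through:
  assumes "e \<in> uedges G" "v \<in> e"
  obtains w where "e = {v, w}" "w \<noteq> v"
proof -
  obtain a b where "e = {a, b}" "a \<noteq> b" using edgeE[OF assms(1)] by metis
  then show ?thesis using assms(2) that[of a] that[of b] by (auto simp: insert_commute)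
qed

lemma edge_eq:
  assumes "e \<in> uedges G" "u \<in> e" "v \<in> e" "u \<noteq> v"
  shows "e = {u, v}"
proof -
  obtain w where "e = {u, w}" using edge_through[OF assms(1,2)] by blast
  then show ?thesis using assms(3,4) by auto
qed

lemma degree_one_unique:
  assumes "udegree G v = 1" "e \<in> uedges G" "v \<in> e" "f \<in> uedges G" "v \<in> f"
  shows "e = f"
proof -
  obtain g where "rooted_star G v = {g}"
    using assms(1) unfolding udegree_def by (rule card_1_singletonE)
  moreover have "e \<in> rooted_star G v" "f \<in> rooted_star G v"
    using assms unfolding rooted_star_def by auto
  ultimately show ?thesis by simp
qed

text \<open>Pairwise intersecting edges of a simple graph share a vertex or form a triangle, and
  bipartiteness excludes the triangle: if \<open>f\<close> misses one end of \<open>{a, b}\<close>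
  and \<open>g\<close> the other, then \<open>f\<close> and \<open>g\<close> differ on both sides
  and are disjoint.\<close>

lemma common_star:
  assumes "T \<subseteq> uedges G" "T \<noteq> {}" and meet: "\<And>e f. e \<in> T \<Longrightarrow> f \<in> T \<Longrightarrow> e \<inter> f \<noteq> {}"
  obtains v where "v \<in> uverts G" "T \<subseteq> rooted_star G v"
proof -
  obtain e where e: "e \<in> T" using assms(2) by blast
  obtain a b where ab: "a \<in> A" "b \<in> B" "e = {a, b}" "a \<notin> B" "b \<notin> A"
    using edgeE[OF subsetD[OF assms(1) e]] by blast
  have "(\<forall>f\<in>T. a \<in> f) \<or> (\<forall>f\<in>T. b \<in> f)"
  proof (rule ccontr)
    assume "\<not> ?thesis"
    then obtain f g where fg: "f \<in> T" "a \<notin> f" "g \<in> T" "b \<notin> g" by blast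
    have 1: "b \<in> f" using meet[OF e fg(1)] fg ab by auto
    have 2: "a \<in> g" using meet[OF e fg(3)] fg ab by auto
    obtain a1 b1 where f: "a1 \<in> A" "b1 \<in> B" "f = {a1, b1}" "a1 \<notin> B" "b1 \<notin> A"
      using edgeE[OF subsetD[OF assms(1) fg(1)]] by blast
    obtain a2 b2 where g: "a2 \<in> A" "b2 \<in> B" "g = {a2, b2}" "a2 \<notin> B" "b2 \<notin> A"
      using edgeE[OF subsetD[OF assms(1) fg(3)]] by blast
    have "b = b1" "a = a2" using 1 2 f g ab by auto
    moreover have "a1 \<noteq> a2" "b1 \<noteq> b2" using fg(2,4) f(3) g(3) calculation by auto
    ultimately show False using meet[OF fg(1,3)] f(1-4) g(1-4) ab(4,5) by auto
  qed
  moreover have "a \<in> uverts G" "b \<in> uverts G" using ab union by auto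
  ultimately show ?thesis
    using that[of a] that[of b] assms(1) unfolding rooted_star_def by (simp add: subset_iff) blast
qed

lemma maximal_star_above:
  assumes "v \<in> uverts G"
  obtains S where "S \<in> maximal_stars G" "rooted_star G v \<subseteq> S"
proof -
  have "finite (edge_stars G)" unfolding edge_stars_def using finV by auto
  moreover have "rooted_star G v \<in> edge_stars G" using assms unfolding edge_stars_def by blast
  ultimately obtain S where "S \<in> edge_stars G" "rooted_star G v \<subseteq> S"
    "\<forall>S'\<in>edge_stars G. S \<subseteq> S' \<longrightarrow> S = S'"
    using finite_has_maximal2[of "edge_stars G"] by metis
  then show ?thesis using that[of S] unfolding maximal_stars_def by blast
qed

text \<open>Stars at distinct vertices share at most the edge joining them, so a star contained in
  another one has at most one edge.\<close>

lemma internal_star_maximal: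
  assumes v: "v \<in> uverts G" "udegree G v \<noteq> 1" "rooted_star G v \<noteq> {}"
  shows "rooted_star G v \<in> maximal_stars G"
proof -
  have "\<not> rooted_star G v \<subset> rooted_star G w" for w
  proof
    assume sub: "rooted_star G v \<subset> rooted_star G w"
    then have ne: "v \<noteq> w" by auto
    have "rooted_star G v \<subseteq> {{v, w}}"
    proof
      fix e assume "e \<in> rooted_star G v"
      then have "e \<in> uedges G" "v \<in> e" "w \<in> e" using sub unfolding rooted_star_def by auto
      then show "e \<in> {{v, w}}" using edge_eq ne by blast
    qed
    then have "rooted_star G v = {{v, w}}" using v(3) by auto
    then show False using v(2) by (simp add: udegree_def)
  qed
  then show ?thesis using v(1) unfolding maximal_stars_def edge_stars_def by auto
qed

text \<open>Vertices on one side are pairwise nonadjacent, so their stars are disjoint and no edge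
  is counted twice.\<close>

lemma sum_stars:
  fixes \<phi> :: "'a set \<Rightarrow> real"
  assumes "Y \<subseteq> B"
  shows "(\<Sum>e | e \<in> uedges G \<and> e \<inter> Y \<noteq> {}. \<phi> e) = (\<Sum>y\<in>Y. \<Sum>e\<in>rooted_star G y. \<phi> e)"
proof -
  have "{e \<in> uedges G. e \<inter> Y \<noteq> {}} = (\<Union>y\<in>Y. rooted_star G y)"
    unfolding rooted_star_def by auto
  moreover have "finite Y" using assms finB by (rule finite_subset)
  moreover have "rooted_star G x \<inter> rooted_star G y = {}" if "x \<in> Y" "y \<in> Y" "x \<noteq> y" for x y
  proof -
    have False if "e \<in> uedges G" "x \<in> e" "y \<in> e" for e
      using that \<open>x \<in> Y\<close> \<open>y \<in> Y\<close> \<open>x \<noteq> y\<close> assms by (elim edgeE) auto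
    then show ?thesis unfolding rooted_star_def by blast
  qed
  ultimately show ?thesis
    by (simp only:) (rule sum.UNION_disjoint, auto simp: fin_star)
qed

section \<open>From equistarability to extendability\<close>

text \<open>A Hall violator \<open>X\<close> for the graph without the vertices of \<open>e\<close> and \<open>f\<close>, taken minimal so that
  no neighbour of \<open>X\<close> is a leaf, would make the edges that meet \<open>N(X)\<close> but avoid \<open>X\<close> a set of
  weight \<open>|N(X)| - |X| = 1\<close> containing the disjoint edges \<open>e\<close> and \<open>f\<close>.\<close>
lemma internal_matching_side:
  fixes \<phi> :: "'a set \<Rightarrow> real"
  assumes pos: "\<And>e. e \<in> uedges G \<Longrightarrow> \<phi> e > 0"
    and star: "\<And>v. v \<in> uverts G \<Longrightarrow> udegree G v \<noteq> 1 \<Longrightarrow> (\<Sum>e\<in>rooted_star G v. \<phi> e) = 1"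
    and unique: "\<And>F. F \<subseteq> uedges G \<Longrightarrow> (\<Sum>e\<in>F. \<phi> e) = 1 \<Longrightarrow> \<exists>v. F \<subseteq> rooted_star G v"
    and e: "e \<in> uedges G" and f: "f \<in> uedges G" and ef: "e \<inter> f = {}"
  defines "J \<equiv> {v \<in> A. udegree G v \<noteq> 1} - (e \<union> f)"
  shows "\<exists>h. inj_on h J \<and> (\<forall>x\<in>J. {x, h x} \<in> uedges G \<and> h x \<in> B - (e \<union> f))"
proof -
  define D where "D = e \<union> f"
  define N where "N X = {y \<in> B. \<exists>x\<in>X. {x, y} \<in> uedges G}" for X
  have finN: "finite (N X)" for X
    using finB unfolding N_def by simp
  have finJ: "finite J"
    using finA unfolding J_def by simp
  have hall: "card X \<le> card (N X - D)" if "X \<subseteq> J" for X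
    using that
  proof (induction "card X" arbitrary: X rule: less_induct)
    case less
    have XA: "X \<subseteq> A" and XD: "X \<inter> D = {}" and XI: "\<And>x. x \<in> X \<Longrightarrow> udegree G x \<noteq> 1"
      using less.prems unfolding J_def D_def by auto
    have finX: "finite X" using less.prems finJ finite_subset by blast
    show ?case
    proof (rule ccontr)
      assume viol: "\<not> ?case"
      \<comment> \<open>If a leaf \<open>y\<close> hangs from \<open>x \<in> X\<close>, then
        dropping \<open>x\<close> loses at least \<open>y\<close> on the right. Hall's inequality,
        known for \<open>X - {x}\<close> by induction, would then carry over to
        \<open>X\<close>.\<close>
      have noleaf: "udegree G y \<noteq> 1" if y: "y \<in> N X" for y
      proof
        assume deg: "udegree G y = 1"
        obtain x where x: "x \<in> X" "{x, y} \<in> uedges G" using y unfolding N_def by blast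
        have only: "g = {x, y}" if "g \<in> uedges G" "y \<in> g" for g
          using degree_one_unique[OF deg that x(2)] by simp
        have yD: "y \<notin> D" using only[OF e] only[OF f] x(1) XD unfolding D_def by auto
        have "N (X - {x}) \<subseteq> N X - {y}"
          using only XA x(1) disj unfolding N_def by (auto simp: doubleton_eq_iff)
        then have "card (N (X - {x}) - D) \<le> card ((N X - D) - {y})"
          by (intro card_mono) (auto simp: finN)
        also have "\<dots> < card (N X - D)"
          using y yD finN by (intro card_Diff1_less) auto
        finally have "card (N (X - {x}) - D) < card (N X - D)" .
        moreover have "card (X - {x}) < card X" using x(1) finX by (meson card_Diff1_less)
        moreover from this have "card (X - {x}) \<le> card (N (X - {x}) - D)"
          using less.prems by (intro less.hyps) auto
        moreover have "card X = Suc (card (X - {x}))" using x(1) finX by (metis card_Suc_Diff1)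
        ultimately show False using viol by linarith
      qed
      define F where "F = {g \<in> uedges G. g \<inter> N X \<noteq> {} \<and> g \<inter> X = {}}"
      have FE: "F \<subseteq> uedges G" unfolding F_def by auto
      have finF: "finite F" using FE finE finite_subset by blast
      have "N X \<subseteq> B" unfolding N_def by auto
      \<comment> \<open>Every edge at \<open>X\<close> ends in \<open>N X\<close>. The edges at
        \<open>N X\<close> have total weight \<open>|N X|\<close> and those at \<open>X\<close> have
        total weight \<open>|X|\<close>, which leaves the difference for \<open>F\<close>.\<close>
      have "real (card (N X)) = (\<Sum>y\<in>N X. \<Sum>g\<in>rooted_star G y. \<phi> g)"
      proof -
        have "(\<Sum>g\<in>rooted_star G y. \<phi> g) = 1" if "y \<in> N X" for y
          using star[of y] noleaf[OF that] that \<open>N X \<subseteq> B\<close> union by auto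
        then show ?thesis by simp
      qed
      also have "\<dots> = (\<Sum>g | g \<in> uedges G \<and> g \<inter> N X \<noteq> {}. \<phi> g)"
        by (rule sum_stars[symmetric]) fact
      also have "{g. g \<in> uedges G \<and> g \<inter> N X \<noteq> {}} = {g. g \<in> uedges G \<and> g \<inter> X \<noteq> {}} \<union> F"
      proof -
        have "g \<inter> N X \<noteq> {}" if g: "g \<in> uedges G" "g \<inter> X \<noteq> {}" for g
        proof -
          obtain a b where "a \<in> A" "b \<in> B" "g = {a, b}" "a \<notin> B" "b \<notin> A"
            using edgeE[OF g(1)] by blast
          then have "a \<in> X" "b \<in> N X" using g XA unfolding N_def by auto
          then show ?thesis using \<open>g = {a, b}\<close> by auto
        qed
        then show ?thesis unfolding F_def by auto
      qed
      also have "(\<Sum>g\<in>\<dots>. \<phi> g) = (\<Sum>g | g \<in> uedges G \<and> g \<inter> X \<noteq> {}. \<phi> g) + (\<Sum>g\<in>F. \<phi> g)"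
        using finE finF by (intro sum.union_disjoint) (auto simp: F_def)
      also have "(\<Sum>g | g \<in> uedges G \<and> g \<inter> X \<noteq> {}. \<phi> g) = (\<Sum>x\<in>X. \<Sum>g\<in>rooted_star G x. \<phi> g)"
        by (rule bipartition.sum_stars[OF flip XA])
      also have "\<dots> = real (card X)"
      proof -
        have "(\<Sum>g\<in>rooted_star G x. \<phi> g) = 1" if "x \<in> X" for x
          using star[of x] XI[OF that] that XA union by auto
        then show ?thesis by simp
      qed
      finally have wF: "(\<Sum>g\<in>F. \<phi> g) = real (card (N X)) - real (card X)" by simp
      have splitN: "card (N X) \<le> card (N X - D) + card (N X \<inter> D)"
        using card_Un_le[of "N X - D" "N X \<inter> D"] by (simp add: Un_Diff_Int)
      obtain b1 where b1: "e \<inter> B \<subseteq> {b1}" "b1 \<in> e" using edgeE[OF e] by auto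
      obtain b2 where b2: "f \<inter> B \<subseteq> {b2}" "b2 \<in> f" using edgeE[OF f] by auto
      have ND: "N X \<inter> D \<subseteq> {b1, b2}" using b1 b2 \<open>N X \<subseteq> B\<close> unfolding D_def by auto
      \<comment> \<open>Since \<open>X\<close> avoids \<open>D\<close>, neither \<open>e\<close> nor
        \<open>f\<close> meets \<open>X\<close>; each belongs to \<open>F\<close> as soon as its end
        in \<open>B\<close> lies in \<open>N X\<close>.\<close>
      have eF: "e \<in> F" if "b1 \<in> N X" using that e b1 XD unfolding F_def D_def by auto
      have fF: "f \<in> F" if "b2 \<in> N X" using that f b2 XD unfolding F_def D_def by auto
      \<comment> \<open>Bootstrapping: weight at least 0 gives \<open>|X| \<le> |N X|\<close>, so
        the violation requires \<open>N X\<close> to meet \<open>D\<close>. This puts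
        \<open>e\<close> or \<open>f\<close> into \<open>F\<close>, and positivity makes the
        inequality strict. Now the violation requires both \<open>b1\<close> and \<open>b2\<close>
        in \<open>N X\<close>.\<close>
      have "(\<Sum>g\<in>F. \<phi> g) \<ge> 0" using pos FE by (intro sum_nonneg) (auto intro: less_imp_le)
      then have "card X \<le> card (N X)" using wF by simp
      then have "card (N X \<inter> D) \<noteq> 0" using splitN viol by linarith
      then have "N X \<inter> D \<noteq> {}" by auto
      then have "F \<noteq> {}" using ND eF fF by auto
      then have "(\<Sum>g\<in>F. \<phi> g) > 0" using pos FE finF by (intro sum_pos) auto
      then have gt: "card X < card (N X)" using wF by simp
      then have two: "card (N X \<inter> D) \<ge> 2" using splitN viol by linarith
      have "card {b1, b2} \<le> 2" by (simp add: card_insert_if)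
      then have le2: "card (N X \<inter> D) \<le> 2" using card_mono[OF _ ND] by simp
      then have "N X \<inter> D = {b1, b2}"
        using two \<open>card {b1, b2} \<le> 2\<close> ND by (intro card_seteq) auto
      then have in_F: "e \<in> F" "f \<in> F" using eF fF by auto
      have "card (N X) = card X + 1" using gt splitN le2 viol by linarith
      then have "(\<Sum>g\<in>F. \<phi> g) = 1" using wF by simp
      then obtain v where "F \<subseteq> rooted_star G v" using unique FE by blast
      then have "v \<in> e" "v \<in> f" using in_F unfolding rooted_star_def by auto
      then show False using ef by auto
    qed
  qed
  define S where "S x = N {x} - D" for x
  have US: "\<Union>(S ` X) = N X - D" for X unfolding S_def N_def by auto
  have "\<exists>h. inj_on h J \<and> (\<forall>x\<in>J. h x \<in> S x)"
  proof (rule hall_marriage[OF finJ])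
    show "finite (S x)" for x unfolding S_def using finN by simp
    show "card X \<le> card (\<Union>(S ` X))" if "X \<subseteq> J" for X unfolding US using that by (rule hall)
  qed
  then obtain h where "inj_on h J" "\<forall>x\<in>J. h x \<in> S x" by blast
  then show ?thesis unfolding S_def N_def D_def by (intro exI[of _ h]) simp
qed

text \<open>The fixed point decides which edges to keep: \<open>x \<in> P\<close> keeps its
  \<open>h\<close>-edge and \<open>y \<in> Q\<close> its \<open>k\<close>-edge. A vertex of
  \<open>J\<close> outside \<open>P\<close> is the \<open>k\<close>-partner of some vertex of
  \<open>Q\<close>, and symmetrically for \<open>K\<close>, so nothing is left uncovered and no
  vertex is used twice. Everything stays away from \<open>D\<close>, which leaves room for the given
  2-matching.\<close>

lemma merge_matchings:
  fixes h k :: "'a \<Rightarrow> 'a"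
  assumes h: "inj_on h J" "\<And>x. x \<in> J \<Longrightarrow> {x, h x} \<in> uedges G \<and> h x \<in> B - D"
    and k: "inj_on k K" "\<And>y. y \<in> K \<Longrightarrow> {y, k y} \<in> uedges G \<and> k y \<in> A - D"
    and J: "J \<subseteq> A - D" and K: "K \<subseteq> B - D"
  obtains M where "graph_matching G M" "J \<union> K \<subseteq> \<Union>M" "\<Union>M \<inter> D = {}"
proof -
  obtain P Q where P: "P = J - k ` Q" and Q: "Q = K - h ` P"
    by (rule schroeder_bernstein_sets)
  define M1 where "M1 = (\<lambda>x. {x, h x}) ` P"
  define M2 where "M2 = (\<lambda>y. {y, k y}) ` Q"
  have PQ: "P \<subseteq> J" "Q \<subseteq> K" using P Q by auto
  have sep: "P \<inter> k ` Q = {}" "Q \<inter> h ` P = {}" using P Q by blast+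
  have cover: "J \<subseteq> P \<union> k ` Q" "K \<subseteq> Q \<union> h ` P" using P Q by blast+
  have hB: "h x \<in> B" "h x \<notin> A" "h x \<notin> D" if "x \<in> P" for x using that PQ h disj by auto
  have kA: "k y \<in> A" "k y \<notin> B" "k y \<notin> D" if "y \<in> Q" for y using that PQ k disj by auto
  have PA: "x \<in> A" "x \<notin> B" "x \<notin> D" if "x \<in> P" for x using that PQ J disj by auto
  have QB: "y \<in> B" "y \<notin> A" "y \<notin> D" if "y \<in> Q" for y using that PQ K disj by auto
  have ne: "u \<noteq> v" if "u \<in> A" "v \<in> B" for u v using that disj by auto
  have hh: "disjnt {x, h x} {x', h x'}" if "x \<in> P" "x' \<in> P" "x \<noteq> x'" for x x'
  proof -
    have "h x \<noteq> h x'" using that inj_on_subset[OF h(1) PQ(1)] inj_onD by metis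
    moreover have "x \<noteq> h x'" "h x \<noteq> x'" using that PA(1) hB(2) by metis+
    ultimately show ?thesis using that by (auto simp: disjnt_def)
  qed
  have kk: "disjnt {y, k y} {y', k y'}" if "y \<in> Q" "y' \<in> Q" "y \<noteq> y'" for y y'
  proof -
    have "k y \<noteq> k y'" using that inj_on_subset[OF k(1) PQ(2)] inj_onD by metis
    moreover have "y \<noteq> k y'" "k y \<noteq> y'" using that QB(1) kA(2) by metis+
    ultimately show ?thesis using that by (auto simp: disjnt_def)
  qed
  have hk: "disjnt {x, h x} {y, k y}" if "x \<in> P" "y \<in> Q" for x y
  proof -
    have "x \<noteq> y" using PA(1)[OF that(1)] QB(2)[OF that(2)] by auto
    moreover have "h x \<noteq> k y" using hB(2)[OF that(1)] kA(1)[OF that(2)] by auto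
    moreover have "x \<noteq> k y" "h x \<noteq> y" using that sep by blast+
    ultimately show ?thesis by (auto simp: disjnt_def)
  qed
  have "disjnt m m'" if "m \<in> M1 \<union> M2" "m' \<in> M1 \<union> M2" "m \<noteq> m'" for m m'
    using that unfolding M1_def M2_def
    by (elim UnE imageE) (metis hh, metis hk, metis hk disjnt_sym, metis kk)
  then have "pairwise disjnt (M1 \<union> M2)" by (rule pairwiseI)
  moreover have "M1 \<union> M2 \<subseteq> uedges G" using h k PQ unfolding M1_def M2_def by auto
  moreover have "J \<union> K \<subseteq> \<Union>(M1 \<union> M2)"
  proof -
    have "P \<subseteq> \<Union>M1" "h ` P \<subseteq> \<Union>M1" "Q \<subseteq> \<Union>M2" "k ` Q \<subseteq> \<Union>M2" unfolding M1_def M2_def by auto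
    then have "P \<union> k ` Q \<subseteq> \<Union>(M1 \<union> M2)" "Q \<union> h ` P \<subseteq> \<Union>(M1 \<union> M2)"
      unfolding Union_Un_distrib by (intro Un_least; blast)+
    then show ?thesis using cover by (intro Un_least) (rule order_trans; assumption)+
  qed
  moreover have "\<Union>(M1 \<union> M2) \<inter> D = {}"
  proof -
    have "{x, h x} \<inter> D = {}" if "x \<in> P" for x using hB(3) PA(3) that by auto
    moreover have "{y, k y} \<inter> D = {}" if "y \<in> Q" for y using kA(3) QB(3) that by auto
    ultimately show ?thesis unfolding M1_def M2_def by blast
  qed
  ultimately show ?thesis using that[of "M1 \<union> M2"] unfolding graph_matching_def by simp
qed

lemma pairs_extend_of_equistarable:
  assumes "equistarable G"
  shows "pairs_extend G"
  unfolding pairs_extend_def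
proof (intro allI impI)
  fix M assume "k_matching G 2 M"
  then obtain e f where M: "M = {e, f}" and ef: "e \<in> uedges G" "f \<in> uedges G" "e \<inter> f = {}"
    unfolding k_matching_2_iff by blast
  obtain \<phi> :: "'a set \<Rightarrow> real" where nonneg: "\<And>e. e \<in> uedges G \<Longrightarrow> \<phi> e \<ge> 0"
    and eq: "\<And>F. F \<subseteq> uedges G \<Longrightarrow> F \<in> maximal_stars G \<longleftrightarrow> (\<Sum>e\<in>F. \<phi> e) = 1"
    using assms unfolding equistarable_def by blast
  \<comment> \<open>An edge of weight 0 could be removed from a maximal star containing it; the
    remainder would still weigh 1 and so be a maximal star properly inside another star.\<close>
  have pos: "\<phi> e > 0" if e: "e \<in> uedges G" for e
  proof (rule ccontr)
    assume "\<not> \<phi> e > 0"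
    then have zero: "\<phi> e = 0" using nonneg[OF e] by simp
    obtain a b where ab: "a \<in> A" "e = {a, b}" using edgeE[OF e] by blast
    have "a \<in> uverts G" using ab(1) union by blast
    then obtain S where S: "S \<in> maximal_stars G" "rooted_star G a \<subseteq> S"
      by (rule maximal_star_above)
    have eS: "e \<in> S" using S(2) e ab(2) unfolding rooted_star_def by auto
    have SE: "S \<subseteq> uedges G" by (rule maximal_star_subset[OF S(1)])
    have "(\<Sum>g\<in>S - {e}. \<phi> g) = 1"
      using eq[OF SE] S(1) zero eS finite_subset[OF SE finE] by (simp add: sum_diff1)
    then have "S - {e} \<in> maximal_stars G" using eq[of "S - {e}"] SE by blast
    then show False using S(1) eS unfolding maximal_stars_def by blast
  qed
  have star: "(\<Sum>e\<in>rooted_star G v. \<phi> e) = 1" if "v \<in> uverts G" "udegree G v \<noteq> 1" for v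
  proof -
    have "rooted_star G v \<noteq> {}"
      using assms that(1) unfolding equistarable_def no_isolated_vertices_def by blast
    then have "rooted_star G v \<in> maximal_stars G" using that by (intro internal_star_maximal)
    then show ?thesis using eq[of "rooted_star G v"] unfolding rooted_star_def by simp
  qed
  have unique: "\<exists>v. F \<subseteq> rooted_star G v" if "F \<subseteq> uedges G" "(\<Sum>e\<in>F. \<phi> e) = 1" for F
    using eq[OF that(1)] that(2) unfolding maximal_stars_def edge_stars_def by blast
  \<comment> \<open>Beyond \<open>M\<close>, exactly the internal vertices outside \<open>?D\<close>
    remain to be covered, by edges that do not touch \<open>?D\<close>.\<close>
  let ?D = "e \<union> f"
  let ?J = "{v \<in> A. udegree G v \<noteq> 1} - ?D"
  let ?K = "{v \<in> B. udegree G v \<noteq> 1} - ?D"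
  obtain h where h: "inj_on h ?J" "\<And>x. x \<in> ?J \<Longrightarrow> {x, h x} \<in> uedges G \<and> h x \<in> B - ?D"
    using internal_matching_side[OF pos star unique ef] by blast
  obtain k where k: "inj_on k ?K" "\<And>y. y \<in> ?K \<Longrightarrow> {y, k y} \<in> uedges G \<and> k y \<in> A - ?D"
    using bipartition.internal_matching_side[OF flip pos star unique ef] by blast
  obtain N where N: "graph_matching G N" "?J \<union> ?K \<subseteq> \<Union>N" "\<Union>N \<inter> ?D = {}"
    by (rule merge_matchings[OF h k]) auto
  have disjD: "disjnt e n" "disjnt n e" "disjnt f n" "disjnt n f" if "n \<in> N" for n
    using N(3) that unfolding disjnt_def by blast+
  have "pairwise disjnt (M \<union> N)"
    using N(1) ef(3) disjD unfolding M graph_matching_def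
    by (simp add: pairwise_insert) (auto simp: disjnt_def)
  then have "graph_matching G (M \<union> N)" using N(1) ef M unfolding graph_matching_def by simp
  moreover have "udegree G v = 1" if v: "v \<in> uverts G - \<Union>(M \<union> N)" for v
  proof -
    have "v \<notin> ?D" "v \<notin> \<Union>N" using v M by auto
    then have "v \<notin> ?J \<union> ?K" "v \<notin> ?D" using N(2) by blast+
    then show ?thesis using v union by blast
  qed
  ultimately show "extends_to_perfect_internal G M"
    unfolding extends_to_perfect_internal_def perfect_internal_matching_def by blast
qed

section \<open>From extendability to strong equistarability\<close>

text \<open>If some edge is disjoint from \<open>e\<close>, the two form a 2-matching. Otherwise
  every edge meets \<open>e\<close>, so all other vertices are leaves and \<open>{e}\<close> is
  already a perfect internal matching.\<close>

lemma extend_edge: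
  assumes iso: "no_isolated_vertices G" and ext: "pairs_extend G" and e: "e \<in> uedges G"
  obtains M where "perfect_internal_matching G M" "e \<in> M"
proof (cases "\<exists>f\<in>uedges G. e \<inter> f = {}")
  case True
  then obtain f where f: "f \<in> uedges G" "e \<inter> f = {}" by blast
  have "e \<noteq> f" using f(2) edgeE[OF e] by blast
  then have "k_matching G 2 {e, f}" unfolding k_matching_2_iff using e f by blast
  then show ?thesis
    using ext that unfolding pairs_extend_def extends_to_perfect_internal_def by blast
next
  case False
  obtain a b where ab: "a \<in> A" "b \<in> B" "e = {a, b}" "a \<notin> B" "b \<notin> A" using edgeE[OF e] by blast
  have "udegree G v = 1" if v: "v \<in> uverts G" "v \<notin> e" for v
  proof -
    obtain g where g: "g \<in> rooted_star G v"
      using iso v(1) unfolding no_isolated_vertices_def by blast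
    have "g' = g" if g': "g' \<in> rooted_star G v" for g'
    proof -
      have "\<exists>w. g = {v, w} \<and> w \<in> e" if "g \<in> rooted_star G v" for g
        using that False v(2) edge_through[of g v] unfolding rooted_star_def
        by (smt (verit) Int_emptyI empty_iff insert_iff mem_Collect_eq)
      then obtain w w' where w: "g = {v, w}" "w \<in> e" "g' = {v, w'}" "w' \<in> e"
        using g g' by meson
      obtain a1 b1 where 1: "a1 \<in> A" "b1 \<in> B" "g = {a1, b1}" "a1 \<notin> B" "b1 \<notin> A"
        using g edgeE[of g] unfolding rooted_star_def by blast
      obtain a2 b2 where 2: "a2 \<in> A" "b2 \<in> B" "g' = {a2, b2}" "a2 \<notin> B" "b2 \<notin> A"
        using g' edgeE[of g'] unfolding rooted_star_def by blast
      \<comment> \<open>A neighbour of \<open>v\<close> lies on the opposite side, and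
        \<open>e\<close> has only one vertex there.\<close>
      have "w \<in> A \<longleftrightarrow> v \<notin> A" "w' \<in> A \<longleftrightarrow> v \<notin> A"
        using 1 2 w(1,3) by (metis doubleton_eq_iff)+
      then have "w = w'" using w(2,4) ab by auto
      then show ?thesis using w by simp
    qed
    then have "rooted_star G v = {g}" using g by blast
    then show ?thesis by (simp add: udegree_def)
  qed
  then have "perfect_internal_matching G {e}"
    using e unfolding perfect_internal_matching_def graph_matching_def by simp
  then show ?thesis using that by blast
qed

text \<open>The edges of the \<open>K\<^sub>2\<close> components have to be added to the matching: their stars are maximal,
  but a perfect internal matching may omit them.\<close>
lemma matching_weight:
  assumes M: "perfect_internal_matching G M"
  obtains \<phi> :: "'a set \<Rightarrow> real" where "\<And>e. \<phi> e \<ge> 0" "\<And>S. S \<in> maximal_stars G \<Longrightarrow> (\<Sum>e\<in>S. \<phi> e) = 1"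
    "\<And>e. e \<in> M \<Longrightarrow> \<phi> e = 1"
proof -
  define I where "I = {e \<in> uedges G. \<forall>v\<in>e. udegree G v = 1}"
  define \<phi> :: "'a set \<Rightarrow> real" where "\<phi> e = of_bool (e \<in> M \<union> I)" for e
  have ME: "M \<subseteq> uedges G" and pw: "pairwise disjnt M"
    using M unfolding perfect_internal_matching_def graph_matching_def by auto
  have "(\<Sum>e\<in>S. \<phi> e) = 1" if S: "S \<in> maximal_stars G" for S
  proof -
    obtain v where v: "v \<in> uverts G" "S = rooted_star G v"
      using S unfolding maximal_stars_def edge_stars_def by blast
    have max: "\<not> S \<subset> rooted_star G w" if "w \<in> uverts G" for w
      using S that unfolding maximal_stars_def edge_stars_def by blast
    have "\<exists>m\<in>S. \<forall>e\<in>S. e \<in> M \<union> I \<longleftrightarrow> e = m"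
    proof (cases "v \<in> \<Union>M")
      case True
      then obtain m where m: "m \<in> M" "v \<in> m" by blast
      have "e = m" if e: "e \<in> S" "e \<in> M \<union> I" for e
      proof (cases "e \<in> M")
        case True
        then show ?thesis
          using pairwiseD[OF pw True m(1)] e m v(2) unfolding rooted_star_def disjnt_def by auto
      next
        case False
        then have "udegree G v = 1" using e v(2) unfolding I_def rooted_star_def by auto
        then show ?thesis
          by (rule degree_one_unique) (use e m v(2) ME in \<open>auto simp: rooted_star_def\<close>)
      qed
      moreover have "m \<in> S" using m ME v(2) unfolding rooted_star_def by auto
      ultimately show ?thesis using m(1) by blast
    next
      case False
      then have deg: "udegree G v = 1"
        using M v(1) unfolding perfect_internal_matching_def by blast
      then obtain m where m: "S = {m}"
        unfolding v(2) udegree_def by (rule card_1_singletonE)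
      then have mE: "m \<in> uedges G" using v(2) unfolding rooted_star_def by auto
      \<comment> \<open>A maximal star at an uncovered leaf is the single edge \<open>m\<close>. By
        maximality the star at the other end of \<open>m\<close> cannot be larger, so
        \<open>m\<close> is a component by itself.\<close>
      have "udegree G w = 1" if w: "w \<in> m" for w
      proof -
        have "w \<in> uverts G" using w mE edge_subset by blast
        moreover have "S \<subseteq> rooted_star G w" using m mE w unfolding rooted_star_def by auto
        ultimately have "rooted_star G w = S" using max by blast
        then show ?thesis using m by (simp add: udegree_def)
      qed
      then have "m \<in> I" using mE unfolding I_def by blast
      then show ?thesis using m by auto
    qed
    then obtain m where m: "m \<in> S" "\<And>e. e \<in> S \<Longrightarrow> e \<in> M \<union> I \<longleftrightarrow> e = m" by blast
    have "(\<Sum>e\<in>S. \<phi> e) = (\<Sum>e\<in>S. if e = m then 1 else 0)"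
      using m(2) unfolding \<phi>_def by (intro sum.cong) auto
    also have "\<dots> = 1" using m(1) fin_star v(2) by simp
    finally show ?thesis .
  qed
  then show ?thesis using that[of \<phi>] unfolding \<phi>_def by auto
qed

text \<open>The matching is chosen so as to push the weight of \<open>T\<close> away from
  \<open>\<gamma>\<close>. For \<open>\<gamma> < 1\<close> it contains an edge of \<open>T\<close>,
  giving weight at least 1. For \<open>\<gamma> = 1\<close> it contains two disjoint edges of
  \<open>T\<close> if there are any, giving at least 2. Otherwise \<open>T\<close> is properly
  contained in a maximal star \<open>S\<close>, and an edge of \<open>S - T\<close> takes the whole
  weight of \<open>S\<close>, leaving 0 for \<open>T\<close>.\<close>

lemma strongly_equistarable_of_pairs_extend:
  assumes iso: "no_isolated_vertices G" and ext: "pairs_extend G"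
  shows "strongly_equistarable G"
  unfolding strongly_equistarable_def
proof (intro conjI ballI allI impI)
  fix T and \<gamma> :: real
  assume "T \<in> nonmaximal_star_sets G" and \<gamma>: "\<gamma> \<le> 1"
  then have T: "T \<subseteq> uedges G" "T \<noteq> {}" "T \<notin> maximal_stars G"
    unfolding nonmaximal_star_sets_def by auto
  have finT: "finite T" using T(1) finE by (rule finite_subset)
  \<comment> \<open>Any weight that is 1 on \<open>M\<close> will do, which separates the choice of
    \<open>M\<close> from the construction of the weight in \<open>matching_weight\<close>.\<close>
  have "\<exists>M. perfect_internal_matching G M \<and> (\<forall>\<phi>::'a set \<Rightarrow> real. (\<forall>e. \<phi> e \<ge> 0) \<longrightarrow>
      (\<forall>S\<in>maximal_stars G. (\<Sum>e\<in>S. \<phi> e) = 1) \<longrightarrow> (\<forall>e\<in>M. \<phi> e = 1) \<longrightarrow> (\<Sum>e\<in>T. \<phi> e) \<noteq> \<gamma>)"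
  proof (cases "\<gamma> < 1")
    case True
    obtain e where e: "e \<in> T" using T(2) by blast
    then have "e \<in> uedges G" using T(1) by blast
    then obtain M where M: "perfect_internal_matching G M" "e \<in> M" by (rule extend_edge[OF iso ext])
    have "(\<Sum>e\<in>T. \<phi> e) \<noteq> \<gamma>" if "\<forall>e. \<phi> e \<ge> 0" "\<forall>e\<in>M. \<phi> e = 1" for \<phi> :: "'a set \<Rightarrow> real"
      using member_le_sum[of e T \<phi>] e finT that M(2) True by auto
    then show ?thesis using M(1) by blast
  next
    case False
    then have \<gamma>1: "\<gamma> = 1" using \<gamma> by simp
    show ?thesis
    proof (cases "\<exists>e\<in>T. \<exists>f\<in>T. e \<inter> f = {}")
      case True
      then obtain e f where ef: "e \<in> T" "f \<in> T" "e \<inter> f = {}" by blast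
      have ne: "e \<noteq> f" using ef(3) edgeE[OF subsetD[OF T(1) ef(1)]] by blast
      have "k_matching G 2 {e, f}" unfolding k_matching_2_iff using ef ne T(1) by blast
      then obtain M where M: "perfect_internal_matching G M" "{e, f} \<subseteq> M"
        using ext unfolding pairs_extend_def extends_to_perfect_internal_def by blast
      have "(\<Sum>e\<in>T. \<phi> e) \<noteq> \<gamma>" if "\<forall>e. \<phi> e \<ge> 0" "\<forall>e\<in>M. \<phi> e = 1" for \<phi> :: "'a set \<Rightarrow> real"
      proof -
        have "(\<Sum>g\<in>{e, f}. \<phi> g) \<le> (\<Sum>e\<in>T. \<phi> e)"
          using that(1) finT ef by (intro sum_mono2) auto
        then show ?thesis using that(2) M(2) ne \<gamma>1 by simp
      qed
      then show ?thesis using M(1) by blast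
    next
      case False
      then have "\<And>e f. e \<in> T \<Longrightarrow> f \<in> T \<Longrightarrow> e \<inter> f \<noteq> {}" by blast
      then obtain v where v: "v \<in> uverts G" "T \<subseteq> rooted_star G v"
        by (rule common_star[OF T(1,2)])
      obtain S where S: "S \<in> maximal_stars G" "rooted_star G v \<subseteq> S"
        by (rule maximal_star_above[OF v(1)])
      have TS: "T \<subseteq> S" using v(2) S(2) by (rule order_trans)
      moreover have "T \<noteq> S" using T(3) S(1) by auto
      ultimately obtain e where e: "e \<in> S" "e \<notin> T" by blast
      have SE: "S \<subseteq> uedges G" by (rule maximal_star_subset[OF S(1)])
      have finS: "finite S" using SE finE by (rule finite_subset)
      have "e \<in> uedges G" using e(1) SE by blast
      then obtain M where M: "perfect_internal_matching G M" "e \<in> M" by (rule extend_edge[OF iso ext])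
      have "(\<Sum>e\<in>T. \<phi> e) \<noteq> \<gamma>"
        if \<phi>: "\<forall>e. \<phi> e \<ge> 0" "\<forall>S\<in>maximal_stars G. (\<Sum>e\<in>S. \<phi> e) = 1" "\<forall>e\<in>M. \<phi> e = 1"
        for \<phi> :: "'a set \<Rightarrow> real"
      proof -
        have "(\<Sum>g\<in>T. \<phi> g) \<le> (\<Sum>g\<in>S - {e}. \<phi> g)"
          using \<phi>(1) finS TS e by (intro sum_mono2) auto
        also have "\<dots> = 0" using \<phi>(2,3) S(1) M(2) e(1) finS by (simp add: sum_diff1)
        finally show ?thesis using \<gamma>1 by simp
      qed
      then show ?thesis using M(1) by blast
    qed
  qed
  then obtain M where M: "perfect_internal_matching G M"
    and ne: "\<And>\<phi>::'a set \<Rightarrow> real. (\<forall>e. \<phi> e \<ge> 0) \<Longrightarrow> (\<forall>S\<in>maximal_stars G. (\<Sum>e\<in>S. \<phi> e) = 1) \<Longrightarrow>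
      (\<forall>e\<in>M. \<phi> e = 1) \<Longrightarrow> (\<Sum>e\<in>T. \<phi> e) \<noteq> \<gamma>"
    by blast
  obtain \<phi> :: "'a set \<Rightarrow> real" where "\<And>e. \<phi> e \<ge> 0"
    "\<And>S. S \<in> maximal_stars G \<Longrightarrow> (\<Sum>e\<in>S. \<phi> e) = 1" "\<And>e. e \<in> M \<Longrightarrow> \<phi> e = 1"
    using matching_weight[OF M] by metis
  then show "\<exists>\<phi>::'a set \<Rightarrow> real. (\<forall>e\<in>uedges G. \<phi> e \<ge> 0) \<and>
      (\<forall>S\<in>maximal_stars G. (\<Sum>e\<in>S. \<phi> e) = 1) \<and> (\<Sum>e\<in>T. \<phi> e) \<noteq> \<gamma>"
    using ne[of \<phi>] by blast
qed (rule iso)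

end

section \<open>From strong equistarability to equistarability\<close>

text \<open>On the segment between two weights each finite sum is affine, so it equals \<open>1\<close> at most once
  unless it is constant.\<close>
lemma avoid_weight_one:
  fixes P :: "('b \<Rightarrow> real) set"
  assumes "finite \<T>" and "P \<noteq> {}"
    and convex: "\<And>\<phi> \<psi> t. \<phi> \<in> P \<Longrightarrow> \<psi> \<in> P \<Longrightarrow> 0 \<le> t \<Longrightarrow> t \<le> 1 \<Longrightarrow> (\<lambda>e. (1 - t) * \<phi> e + t * \<psi> e) \<in> P"
    and "\<And>T. T \<in> \<T> \<Longrightarrow> \<exists>\<phi>\<in>P. (\<Sum>e\<in>T. \<phi> e) \<noteq> 1"
  shows "\<exists>\<phi>\<in>P. \<forall>T\<in>\<T>. (\<Sum>e\<in>T. \<phi> e) \<noteq> 1"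
  using assms(1,4)
proof (induction \<T>)
  case empty
  then show ?case using \<open>P \<noteq> {}\<close> by auto
next
  case (insert T \<T>)
  obtain \<phi> where \<phi>: "\<phi> \<in> P" "\<And>U. U \<in> \<T> \<Longrightarrow> (\<Sum>e\<in>U. \<phi> e) \<noteq> 1"
    using insert.IH insert.prems by blast
  obtain \<psi> where \<psi>: "\<psi> \<in> P" "(\<Sum>e\<in>T. \<psi> e) \<noteq> 1" using insert.prems by blast
  show ?case
  proof (cases "(\<Sum>e\<in>T. \<phi> e) = 1")
    case False
    then show ?thesis using \<phi> by blast
  next
    case True
    \<comment> \<open>For each \<open>U\<close> this is the only parameter at which its sum could be
      1. If both sums over \<open>U\<close> agree, the quotient is 0 by convention, outside the open
      interval, and the sum over \<open>U\<close> keeps a constant value other than 1. For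
      \<open>T\<close> every positive parameter works.\<close>
    let ?bad = "(\<lambda>U. (1 - (\<Sum>e\<in>U. \<phi> e)) / ((\<Sum>e\<in>U. \<psi> e) - (\<Sum>e\<in>U. \<phi> e))) ` \<T>"
    have "infinite ({0<..<1::real} - ?bad)"
      using insert.hyps(1) by (intro Diff_infinite_finite) (auto simp: infinite_Ioo)
    then obtain t where t: "0 < t" "t < 1" "t \<notin> ?bad"
      by (metis (no_types, lifting) DiffE ex_in_conv finite.emptyI greaterThanLessThan_iff)
    let ?\<chi> = "\<lambda>e. (1 - t) * \<phi> e + t * \<psi> e"
    have sum: "(\<Sum>e\<in>U. ?\<chi> e) = (\<Sum>e\<in>U. \<phi> e) + t * ((\<Sum>e\<in>U. \<psi> e) - (\<Sum>e\<in>U. \<phi> e))" for U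
      by (simp add: sum.distrib flip: sum_distrib_left) (simp add: algebra_simps)
    have "?\<chi> \<in> P" using convex \<phi>(1) \<psi>(1) t by simp
    moreover have "(\<Sum>e\<in>T. ?\<chi> e) \<noteq> 1" using True \<psi>(2) t(1) unfolding sum by simp
    moreover have "(\<Sum>e\<in>U. ?\<chi> e) \<noteq> 1" if U: "U \<in> \<T>" for U
    proof
      assume "(\<Sum>e\<in>U. ?\<chi> e) = 1"
      then have eq: "t * ((\<Sum>e\<in>U. \<psi> e) - (\<Sum>e\<in>U. \<phi> e)) = 1 - (\<Sum>e\<in>U. \<phi> e)" unfolding sum by simp
      then have "(\<Sum>e\<in>U. \<psi> e) - (\<Sum>e\<in>U. \<phi> e) \<noteq> 0" using \<phi>(2)[OF U] by auto
      then have "t = (1 - (\<Sum>e\<in>U. \<phi> e)) / ((\<Sum>e\<in>U. \<psi> e) - (\<Sum>e\<in>U. \<phi> e))"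
        using eq by (simp add: eq_divide_eq)
      then show False using t(3) U by blast
    qed
    ultimately show ?thesis by blast
  qed
qed

lemma equistarable_of_strongly:
  assumes fin: "finite (uedges G)" and str: "strongly_equistarable G"
  shows "equistarable G"
proof -
  have iso: "no_isolated_vertices G" using str unfolding strongly_equistarable_def by blast
  define P where "P = {\<phi> :: 'a set \<Rightarrow> real. (\<forall>e\<in>uedges G. \<phi> e \<ge> 0) \<and>
    (\<forall>S\<in>maximal_stars G. (\<Sum>e\<in>S. \<phi> e) = 1)}"
  have sep: "\<exists>\<phi>\<in>P. (\<Sum>e\<in>T. \<phi> e) \<noteq> 1" if "T \<in> nonmaximal_star_sets G" for T
    using str that unfolding strongly_equistarable_def P_def by blast
  \<comment> \<open>Without sets to separate, the hypothesis supplies no weight. In that case every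
    single edge is a maximal star, so all maximal stars are singletons and the constant 1 is
    admissible.\<close>
  have ne: "P \<noteq> {}"
  proof (cases "nonmaximal_star_sets G = {}")
    case False
    then show ?thesis using sep by blast
  next
    case True
    have "card S = 1" if S: "S \<in> maximal_stars G" for S
    proof -
      have "S \<noteq> {}" using S iso
        unfolding maximal_stars_def edge_stars_def no_isolated_vertices_def by blast
      then obtain e where e: "e \<in> S" by blast
      have "{e} \<notin> nonmaximal_star_sets G" using True by simp
      moreover have "{e} \<subseteq> uedges G" using maximal_star_subset[OF S] e by blast
      ultimately have "{e} \<in> maximal_stars G" unfolding nonmaximal_star_sets_def by simp
      moreover have "S \<in> edge_stars G" using S unfolding maximal_stars_def by simp
      ultimately have "\<not> {e} \<subset> S" unfolding maximal_stars_def by simp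
      then have "S = {e}" using e by blast
      then show ?thesis by simp
    qed
    then have "(\<lambda>_. 1) \<in> P" unfolding P_def by simp
    then show ?thesis by blast
  qed
  have fin_T: "finite (nonmaximal_star_sets G)"
    by (rule finite_subset[of _ "Pow (uedges G)"]) (auto simp: nonmaximal_star_sets_def fin)
  have conv: "(\<lambda>e. (1 - t) * \<phi> e + t * \<psi> e) \<in> P"
    if "\<phi> \<in> P" "\<psi> \<in> P" "0 \<le> t" "t \<le> 1" for \<phi> \<psi> t
  proof -
    have "(\<Sum>e\<in>S. (1 - t) * \<phi> e + t * \<psi> e) = (1 - t) * (\<Sum>e\<in>S. \<phi> e) + t * (\<Sum>e\<in>S. \<psi> e)" for S
      by (simp add: sum.distrib sum_distrib_left)
    then show ?thesis using that unfolding P_def by simp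
  qed
  have "\<exists>\<phi>\<in>P. \<forall>T\<in>nonmaximal_star_sets G. (\<Sum>e\<in>T. \<phi> e) \<noteq> 1"
    by (rule avoid_weight_one[OF fin_T ne]) (fact conv, fact sep)
  then obtain \<phi> where \<phi>: "\<phi> \<in> P" "\<And>T. T \<in> nonmaximal_star_sets G \<Longrightarrow> (\<Sum>e\<in>T. \<phi> e) \<noteq> 1"
    by blast
  have "F \<in> maximal_stars G" if F: "F \<subseteq> uedges G" "(\<Sum>e\<in>F. \<phi> e) = 1" for F
  proof (rule ccontr)
    assume "F \<notin> maximal_stars G"
    moreover have "F \<noteq> {}" using F(2) by auto
    ultimately have "F \<in> nonmaximal_star_sets G" using F(1) unfolding nonmaximal_star_sets_def by blast
    then show False using \<phi>(2) F(2) by blast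
  qed
  moreover have "\<forall>e\<in>uedges G. \<phi> e \<ge> 0" "\<forall>S\<in>maximal_stars G. (\<Sum>e\<in>S. \<phi> e) = 1"
    using \<phi>(1) unfolding P_def by auto
  ultimately show ?thesis using iso unfolding equistarable_def by metis
qed

section \<open>Components\<close>

text \<open>This replaces isomorphisms by an incidence condition. The centre is the preimage of
  \<open>0\<close>; conversely, since no vertex is isolated, a vertex on all edges is adjacent to
  every other vertex, and any numbering of the others is an isomorphism.\<close>

lemma star_graph_iff:
  assumes V: "finite (uverts G)" and E: "\<And>e. e \<in> uedges G \<Longrightarrow> e \<subseteq> uverts G \<and> card e = 2"
    and iso: "no_isolated_vertices G"
  shows "star_graph G \<longleftrightarrow> (\<exists>c\<in>uverts G. \<forall>e\<in>uedges G. c \<in> e)"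
proof
  have K: "{i, j} \<in> uedges (complete_bipartite_1 n) \<longleftrightarrow>
      i = 0 \<and> j \<in> {1..n} \<or> j = 0 \<and> i \<in> {1..n}" for i j n
    unfolding complete_bipartite_1_def by (auto simp: doubleton_eq_iff)
  {
    assume "star_graph G"
    then obtain n f where f: "bij_betw f (uverts G) {0..n}"
      and iff: "\<And>u v. u \<in> uverts G \<Longrightarrow> v \<in> uverts G \<Longrightarrow>
        {u, v} \<in> uedges G \<longleftrightarrow> {f u, f v} \<in> uedges (complete_bipartite_1 n)"
      unfolding star_graph_def graph_isomorphic_def complete_bipartite_1_def by auto
    obtain c where c: "c \<in> uverts G" "f c = 0"
      using bij_betw_imp_surj_on[OF f] by (metis atLeastAtMost_iff imageE le0)
    have "c \<in> e" if e: "e \<in> uedges G" for e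
    proof -
      obtain u v where uv: "e = {u, v}" using E[OF e] by (metis card_2_iff)
      then have mem: "u \<in> uverts G" "v \<in> uverts G" using E[OF e] by auto
      then have "f u = f c \<or> f v = f c" using iff[OF mem] e uv c(2) by (auto simp: K)
      then show ?thesis using inj_onD[OF bij_betw_imp_inj_on[OF f]] mem c(1) uv by blast
    qed
    then show "\<exists>c\<in>uverts G. \<forall>e\<in>uedges G. c \<in> e" using c(1) by blast
  next
    assume "\<exists>c\<in>uverts G. \<forall>e\<in>uedges G. c \<in> e"
    then obtain c where c: "c \<in> uverts G" "\<And>e. e \<in> uedges G \<Longrightarrow> c \<in> e" by blast
    have edge: "{u, v} \<in> uedges G \<longleftrightarrow> u = c \<and> v \<noteq> c \<or> v = c \<and> u \<noteq> c"
      if uv: "u \<in> uverts G" "v \<in> uverts G" for u v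
    proof
      assume e: "{u, v} \<in> uedges G"
      then have "u \<noteq> v" using E[OF e] by auto
      then show "u = c \<and> v \<noteq> c \<or> v = c \<and> u \<noteq> c" using c(2)[OF e] by auto
    next
      have *: "{c, w} \<in> uedges G" if w: "w \<in> uverts G" "w \<noteq> c" for w
      proof -
        obtain e where e: "e \<in> uedges G" "w \<in> e"
          using iso w(1) unfolding no_isolated_vertices_def rooted_star_def by blast
        obtain x y where "e = {x, y}" using E[OF e(1)] by (metis card_2_iff)
        then have "e = {c, w}" using e(2) c(2)[OF e(1)] w(2) by auto
        then show ?thesis using e(1) by simp
      qed
      assume "u = c \<and> v \<noteq> c \<or> v = c \<and> u \<noteq> c"
      then show "{u, v} \<in> uedges G" using *[of u] *[of v] uv by (metis insert_commute)
    qed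
    let ?W = "uverts G - {c}"
    obtain g where g: "bij_betw g ?W {1..card ?W}"
      using finite_same_card_bij[of ?W "{1..card ?W}"] V by auto
    define f where "f v = (if v = c then 0 else g v)" for v
    have gf: "bij_betw f ?W {1..card ?W}"
      using g by (rule bij_betw_cong[THEN iffD1, rotated]) (auto simp: f_def)
    have "bij_betw f (?W \<union> {c}) ({1..card ?W} \<union> {f c})"
      using gf by (intro notIn_Un_bij_betw) (auto simp: f_def)
    moreover have "?W \<union> {c} = uverts G" using c(1) by auto
    moreover have "{1..card ?W} \<union> {f c} = {0..card ?W}" by (auto simp: f_def)
    ultimately have bij: "bij_betw f (uverts G) {0..card ?W}" by simp
    have "{u, v} \<in> uedges G \<longleftrightarrow> {f u, f v} \<in> uedges (complete_bipartite_1 (card ?W))"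
      if uv: "u \<in> uverts G" "v \<in> uverts G" for u v
    proof -
      have "f w = 0 \<longleftrightarrow> w = c" "f w \<in> {1..card ?W} \<longleftrightarrow> w \<noteq> c" if "w \<in> uverts G" for w
        using bij_betwE[OF gf, rule_format, of w] that by (auto simp: f_def)
      then show ?thesis unfolding K edge[OF uv] using uv by auto
    qed
    then have "graph_isomorphic G (complete_bipartite_1 (card ?W))"
      using bij unfolding graph_isomorphic_def by (auto simp: complete_bipartite_1_def)
    moreover have "1 \<le> card ?W"
    proof -
      obtain e where e: "e \<in> uedges G" "c \<in> e"
        using iso c(1) unfolding no_isolated_vertices_def rooted_star_def by blast
      then obtain w where "w \<in> e" "w \<noteq> c"
        using E[OF e(1)] by (metis card_2_iff insertCI)
      then have "w \<in> ?W" using E[OF e(1)] by auto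
      then show ?thesis using V by (metis One_nat_def Suc_leI card_gt_0_iff empty_iff finite_Diff)
    qed
    ultimately show "star_graph G" unfolding star_graph_def by blast
  }
qed

definition component :: "'a ugraph \<Rightarrow> 'a \<Rightarrow> 'a set" where
  "component G u = {v \<in> uverts G. graph_reachable G u v}"

lemma component_refl: "u \<in> uverts G \<Longrightarrow> u \<in> component G u"
  unfolding component_def graph_reachable_def by simp

lemma component_eq:
  assumes "v \<in> component G u"
  shows "component G v = component G u"
proof -
  let ?R = "{(x, y). {x, y} \<in> uedges G}"
  have "sym ?R" by (auto simp: sym_def insert_commute)
  then have "(v, u) \<in> ?R\<^sup>*" "(u, v) \<in> ?R\<^sup>*"
    using assms sym_rtrancl[of ?R] unfolding component_def graph_reachable_def
    by (auto dest: symD)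
  then show ?thesis unfolding component_def graph_reachable_def by (auto intro: rtrancl_trans)
qed

lemma graph_components_eq:
  "graph_components G = {induced_graph G (component G u) | u. u \<in> uverts G}"
  unfolding graph_components_def component_def ..

section \<open>Restriction to components and gluing\<close>

context bipartition
begin

lemma component_closed:
  assumes "e \<in> uedges G" "e \<inter> component G u \<noteq> {}"
  shows "e \<subseteq> component G u"
proof -
  obtain v where v: "v \<in> e" "v \<in> component G u" using assms(2) by blast
  then obtain w where w: "e = {v, w}" using edge_through[OF assms(1)] by blast
  then have "graph_reachable G u w"
    using v(2) assms(1) unfolding component_def graph_reachable_def
    by (auto intro: rtrancl_into_rtrancl)
  moreover have "w \<in> uverts G" using w edge_subset[OF assms(1)] by auto
  ultimately show ?thesis using w v(2) unfolding component_def by auto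
qed

lemma induced_star:
  assumes "v \<in> component G u"
  shows "rooted_star (induced_graph G (component G u)) v = rooted_star G v"
  using component_closed assms unfolding rooted_star_def induced_graph_def by auto

lemma induced_bipartition:
  "bipartition (induced_graph G (component G u)) (A \<inter> component G u) (B \<inter> component G u)"
proof
  show "finite (uverts (induced_graph G (component G u)))"
    using finV unfolding induced_graph_def component_def by simp
  show "A \<inter> component G u \<union> B \<inter> component G u = uverts (induced_graph G (component G u))"
    using union unfolding induced_graph_def component_def by auto
  show "A \<inter> component G u \<inter> (B \<inter> component G u) = {}" using disj by auto
  fix e assume "e \<in> uedges (induced_graph G (component G u))"
  then have e: "e \<in> uedges G" "e \<subseteq> component G u" unfolding induced_graph_def by auto
  then show "\<exists>a\<in>A \<inter> component G u. \<exists>b\<in>B \<inter> component G u. e = {a, b}"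
    using edges[OF e(1)] by auto
qed

lemma induced_no_isolated:
  assumes "no_isolated_vertices G"
  shows "no_isolated_vertices (induced_graph G (component G u))"
  unfolding no_isolated_vertices_def
proof
  fix v assume "v \<in> uverts (induced_graph G (component G u))"
  then have v: "v \<in> component G u" by (simp add: induced_graph_def)
  then show "rooted_star (induced_graph G (component G u)) v \<noteq> {}"
    using assms induced_star[OF v] unfolding no_isolated_vertices_def component_def by auto
qed

lemma induced_connected:
  assumes u: "u \<in> uverts G"
  shows "connected_graph (induced_graph G (component G u))"
proof -
  let ?H = "induced_graph G (component G u)"
  have reach: "graph_reachable ?H u v" if "v \<in> component G u" for v
  proof -
    have "(u, v) \<in> {(x, y). {x, y} \<in> uedges G}\<^sup>*"
      using that unfolding component_def graph_reachable_def by simp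
    \<comment> \<open>Membership in the component is carried through the induction because it is
      what puts the next edge into \<open>?H\<close>.\<close>
    then have "v \<in> component G u \<and> graph_reachable ?H u v"
    proof (induction rule: rtrancl_induct)
      case base
      then show ?case using component_refl[OF u] by (simp add: graph_reachable_def)
    next
      case (step y z)
      then have "{y, z} \<in> uedges G" "{y, z} \<inter> component G u \<noteq> {}" by auto
      then have "{y, z} \<subseteq> component G u" "{y, z} \<in> uedges ?H"
        using component_closed[of "{y, z}" u] by (auto simp: induced_graph_def)
      then show ?case
        using step.IH unfolding graph_reachable_def by (auto intro: rtrancl_into_rtrancl)
    qed
    then show ?thesis by simp
  qed
  have "sym {(x, y). {x, y} \<in> uedges ?H}" by (auto simp: sym_def insert_commute)
  then have "sym ({(x, y). {x, y} \<in> uedges ?H}\<^sup>*)" by (rule sym_rtrancl)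
  then have "graph_reachable ?H v w" if "v \<in> component G u" "w \<in> component G u" for v w
    using reach[OF that(1)] reach[OF that(2)] unfolding graph_reachable_def
    by (meson rtrancl_trans symD)
  moreover have "uverts ?H = component G u" by (simp add: induced_graph_def)
  ultimately show ?thesis
    using component_refl[OF u] unfolding connected_graph_def by auto
qed

text \<open>No edge leaves a component and degrees do not change there, so a perfect internal
  matching of the whole graph restricts to one of the component.\<close>

lemma induced_pairs_extend:
  assumes "pairs_extend G"
  shows "pairs_extend (induced_graph G (component G u))"
  unfolding pairs_extend_def
proof (intro allI impI)
  let ?H = "induced_graph G (component G u)"
  fix M assume M: "k_matching ?H 2 M"
  have MH: "M \<subseteq> uedges G" "\<And>e. e \<in> M \<Longrightarrow> e \<subseteq> component G u"
    using M unfolding k_matching_def graph_matching_def induced_graph_def by auto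
  have "k_matching G 2 M" using M MH(1) unfolding k_matching_def graph_matching_def by simp
  then obtain N where N: "perfect_internal_matching G N" "M \<subseteq> N"
    using assms unfolding pairs_extend_def extends_to_perfect_internal_def by blast
  have NE: "N \<subseteq> uedges G" "pairwise disjnt N"
    using N(1) unfolding perfect_internal_matching_def graph_matching_def by auto
  let ?N = "{e \<in> N. e \<subseteq> component G u}"
  have "graph_matching ?H ?N"
    using NE pairwise_subset[of disjnt N ?N] unfolding graph_matching_def induced_graph_def by auto
  moreover have "udegree ?H v = 1" if v: "v \<in> uverts ?H - \<Union>?N" for v
  proof -
    have vu: "v \<in> component G u" using v by (simp add: induced_graph_def)
    have "v \<notin> \<Union>N"
    proof
      assume "v \<in> \<Union>N"
      then obtain e where e: "e \<in> N" "v \<in> e" by blast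
      then have "e \<subseteq> component G u" using component_closed[of e u] vu NE(1) by blast
      then show False using v e by blast
    qed
    then have "udegree G v = 1"
      using N(1) vu unfolding perfect_internal_matching_def component_def by blast
    then show ?thesis using induced_star[OF vu] by (simp add: udegree_def)
  qed
  ultimately have "perfect_internal_matching ?H ?N" unfolding perfect_internal_matching_def by blast
  moreover have "M \<subseteq> ?N" using N(2) MH(2) by blast
  ultimately show "extends_to_perfect_internal ?H M"
    unfolding extends_to_perfect_internal_def by blast
qed

lemma pairs_extend_of_components:
  assumes iso: "no_isolated_vertices G"
    and ext: "\<And>u. u \<in> uverts G \<Longrightarrow> pairs_extend (induced_graph G (component G u))"
  shows "pairs_extend G"
  unfolding pairs_extend_def
proof (intro allI impI)
  fix M assume "k_matching G 2 M"
  then obtain e f where M: "M = {e, f}" and ef: "e \<noteq> f" "e \<in> uedges G" "f \<in> uedges G" "e \<inter> f = {}"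
    unfolding k_matching_2_iff by blast
  have ME: "M \<subseteq> uedges G" using M ef by simp
  \<comment> \<open>Indexing by vertex sets instead of representatives makes the later choice pick
    one matching per component.\<close>
  let ?\<W> = "component G ` uverts G"
  have "\<forall>W\<in>?\<W>. \<exists>N. perfect_internal_matching (induced_graph G W) N \<and> {e \<in> M. e \<subseteq> W} \<subseteq> N"
  proof
    fix W assume "W \<in> ?\<W>"
    then obtain u where u: "u \<in> uverts G" "W = component G u" by blast
    let ?H = "induced_graph G W"
    have bip: "bipartition ?H (A \<inter> W) (B \<inter> W)" unfolding u(2) by (rule induced_bipartition)
    have isoH: "no_isolated_vertices ?H" unfolding u(2) by (rule induced_no_isolated[OF iso])
    have extH: "pairs_extend ?H" unfolding u(2) by (rule ext[OF u(1)])
    have uE: "uedges ?H = {e \<in> uedges G. e \<subseteq> W}" by (simp add: induced_graph_def)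
    have one: "\<exists>N. perfect_internal_matching ?H N \<and> g \<in> N" if "g \<in> uedges ?H" for g
      using bipartition.extend_edge[OF bip isoH extH that] by blast
    have "u \<in> uverts ?H" using component_refl[OF u(1)] u(2) by (simp add: induced_graph_def)
    then have "rooted_star ?H u \<noteq> {}" using isoH unfolding no_isolated_vertices_def by blast
    then obtain g where g: "g \<in> uedges ?H" unfolding rooted_star_def by blast
    show "\<exists>N. perfect_internal_matching ?H N \<and> {e \<in> M. e \<subseteq> W} \<subseteq> N"
    proof (cases "e \<subseteq> W \<and> f \<subseteq> W")
      case True
      then have "k_matching ?H 2 {e, f}" unfolding k_matching_2_iff using ef uE by blast
      then show ?thesis
        using extH[unfolded pairs_extend_def extends_to_perfect_internal_def, rule_format, of "{e, f}"] M
        by auto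
    next
      case False
      \<comment> \<open>At most one edge of \<open>M\<close> lies in \<open>W\<close>. Extending
        that single edge suffices; if there is none, the arbitrary edge \<open>g\<close> takes its
        place.\<close>
      then have "\<exists>h\<in>uedges ?H. {e \<in> M. e \<subseteq> W} \<subseteq> {h}"
        using M ef(2,3) g uE by (cases "e \<subseteq> W"; cases "f \<subseteq> W") auto
      then obtain h where h: "h \<in> uedges ?H" "{e \<in> M. e \<subseteq> W} \<subseteq> {h}" by blast
      obtain N where "perfect_internal_matching ?H N" "h \<in> N" using one[OF h(1)] by blast
      then show ?thesis using h(2) by (intro exI[of _ N]) auto
    qed
  qed
  then obtain N where N: "\<And>W. W \<in> ?\<W> \<Longrightarrow> perfect_internal_matching (induced_graph G W) (N W)"
    "\<And>W. W \<in> ?\<W> \<Longrightarrow> {e \<in> M. e \<subseteq> W} \<subseteq> N W"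
    using bchoice[of ?\<W>] by metis
  have NE: "g \<in> uedges G" "g \<subseteq> W" if "W \<in> ?\<W>" "g \<in> N W" for g W
    using N(1)[OF that(1)] that(2)
    unfolding perfect_internal_matching_def graph_matching_def induced_graph_def by auto
  have Npw: "pairwise disjnt (N W)" if "W \<in> ?\<W>" for W
    using N(1)[OF that] unfolding perfect_internal_matching_def graph_matching_def by simp
  let ?N = "\<Union>W\<in>?\<W>. N W"
  have "disjnt x y" if xy: "x \<in> ?N" "y \<in> ?N" "x \<noteq> y" for x y
  proof (rule ccontr)
    assume "\<not> disjnt x y"
    then obtain v where v: "v \<in> x" "v \<in> y" unfolding disjnt_def by blast
    obtain u where u: "u \<in> uverts G" "x \<in> N (component G u)" using xy(1) by blast
    obtain w where w: "w \<in> uverts G" "y \<in> N (component G w)" using xy(2) by blast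
    have "v \<in> component G u" "v \<in> component G w"
      using NE(2)[OF imageI[OF u(1)] u(2)] NE(2)[OF imageI[OF w(1)] w(2)] v by auto
    then have "component G u = component G w" using component_eq by metis
    then have "disjnt x y" using pairwiseD[OF Npw[OF imageI[OF u(1)]]] u(2) w(2) xy(3) by simp
    then show False using \<open>\<not> disjnt x y\<close> by blast
  qed
  then have "graph_matching G ?N" using NE(1) unfolding graph_matching_def pairwise_def by blast
  moreover have "udegree G v = 1" if v: "v \<in> uverts G" "v \<notin> \<Union>?N" for v
  proof -
    have W: "component G v \<in> ?\<W>" using v(1) by blast
    have vv: "v \<in> component G v" by (rule component_refl[OF v(1)])
    have "v \<in> uverts (induced_graph G (component G v)) - \<Union>(N (component G v))"
      using v W vv by (auto simp: induced_graph_def)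
    then have "udegree (induced_graph G (component G v)) v = 1"
      using N(1)[OF W] unfolding perfect_internal_matching_def by blast
    then show ?thesis using induced_star[OF vv] by (simp add: udegree_def)
  qed
  moreover have "M \<subseteq> ?N"
  proof
    fix g assume g: "g \<in> M"
    then obtain a where a: "a \<in> g" "a \<in> uverts G"
      using ME edge_subset edgeE[of g] by (metis insertI1 subsetD)
    then have "g \<subseteq> component G a"
      using component_closed[of g a] g ME component_refl[OF a(2)] by blast
    then show "g \<in> ?N" using N(2)[OF imageI[OF a(2)]] g a(2) by blast
  qed
  ultimately show "extends_to_perfect_internal G M"
    unfolding extends_to_perfect_internal_def perfect_internal_matching_def by blast
qed

text \<open>This explains the alternative in (a): \<open>internally_extendable 2\<close> demands
  that a 2-matching exists, and the components without one, where (b) holds vacuously, are the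
  stars. Without a 2-matching all edges meet pairwise, so \<open>common_star\<close> provides a
  centre.\<close>

lemma star_graph_iff_no_pair:
  assumes "no_isolated_vertices G" "uverts G \<noteq> {}"
  shows "star_graph G \<longleftrightarrow> \<not> (\<exists>M. k_matching G 2 M)"
proof -
  have E: "e \<subseteq> uverts G \<and> card e = 2" if e: "e \<in> uedges G" for e
  proof -
    obtain a b where "e = {a, b}" "a \<in> A" "b \<notin> A" using edgeE[OF e] by blast
    then have "card e = 2" by (metis card_2_iff)
    then show ?thesis using edge_subset[OF e] by blast
  qed
  have "star_graph G \<longleftrightarrow> (\<exists>c\<in>uverts G. \<forall>e\<in>uedges G. c \<in> e)"
    by (rule star_graph_iff[OF finV _ assms(1)]) (rule E)
  also have "\<dots> \<longleftrightarrow> \<not> (\<exists>M. k_matching G 2 M)"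
  proof
    assume "\<exists>c\<in>uverts G. \<forall>e\<in>uedges G. c \<in> e"
    then show "\<not> (\<exists>M. k_matching G 2 M)" unfolding k_matching_2_iff by blast
  next
    assume no: "\<not> (\<exists>M. k_matching G 2 M)"
    have ne: "uedges G \<noteq> {}"
      using assms unfolding no_isolated_vertices_def rooted_star_def by blast
    have "e \<inter> f \<noteq> {}" if "e \<in> uedges G" "f \<in> uedges G" for e f
    proof (cases "e = f")
      case True
      then show ?thesis using E[OF that(1)] by auto
    next
      case False
      then show ?thesis using no that unfolding k_matching_2_iff by blast
    qed
    then obtain v where "v \<in> uverts G" "uedges G \<subseteq> rooted_star G v"
      using common_star[OF order_refl ne] by blast
    then show "\<exists>c\<in>uverts G. \<forall>e\<in>uedges G. c \<in> e" unfolding rooted_star_def by blast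
  qed
  finally show ?thesis .
qed

lemma components_iff_pairs_extend:
  assumes iso: "no_isolated_vertices G"
  shows "(\<forall>H\<in>graph_components G. star_graph H \<or> internally_extendable 2 H) \<longleftrightarrow> pairs_extend G"
proof -
  have "star_graph H \<or> internally_extendable 2 H \<longleftrightarrow> pairs_extend H"
    if u: "u \<in> uverts G" "H = induced_graph G (component G u)" for u H
  proof -
    have "uverts H \<noteq> {}" using component_refl[OF u(1)] u(2) by (auto simp: induced_graph_def)
    moreover have "no_isolated_vertices H" unfolding u(2) by (rule induced_no_isolated[OF iso])
    moreover have "bipartition H (A \<inter> component G u) (B \<inter> component G u)"
      unfolding u(2) by (rule induced_bipartition)
    ultimately have "star_graph H \<longleftrightarrow> \<not> (\<exists>M. k_matching H 2 M)"
      using bipartition.star_graph_iff_no_pair by blast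
    moreover have "connected_graph H" unfolding u(2) by (rule induced_connected[OF u(1)])
    ultimately show ?thesis unfolding internally_extendable_def pairs_extend_def by blast
  qed
  then have "(\<forall>H\<in>graph_components G. star_graph H \<or> internally_extendable 2 H) \<longleftrightarrow>
      (\<forall>u\<in>uverts G. pairs_extend (induced_graph G (component G u)))"
    unfolding graph_components_eq by blast
  also have "\<dots> \<longleftrightarrow> pairs_extend G"
    using pairs_extend_of_components[OF iso] induced_pairs_extend by blast
  finally show ?thesis .
qed

end

theorem theorem4:
  fixes G :: "'a ugraph"
  assumes "finite_simple_graph G"
    and "bipartite_graph G"
    and "no_isolated_vertices G"
  shows "((\<forall>H\<in>graph_components G. star_graph H \<or> internally_extendable 2 H)
            \<longleftrightarrow> (\<forall>M. k_matching G 2 M \<longrightarrow> extends_to_perfect_internal G M))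
       \<and> ((\<forall>M. k_matching G 2 M \<longrightarrow> extends_to_perfect_internal G M)
            \<longleftrightarrow> strongly_equistarable G)
       \<and> (strongly_equistarable G \<longleftrightarrow> equistarable G)"
proof -
  obtain A B where "A \<union> B = uverts G" "A \<inter> B = {}" "\<forall>e\<in>uedges G. \<exists>a\<in>A. \<exists>b\<in>B. e = {a, b}"
    using assms(2) unfolding bipartite_graph_def by blast
  then interpret bipartition G A B
    using assms(1) unfolding finite_simple_graph_def by unfold_locales auto
  show ?thesis
    unfolding pairs_extend_def[symmetric]
    using components_iff_pairs_extend[OF assms(3)] strongly_equistarable_of_pairs_extend[OF assms(3)]
      equistarable_of_strongly[OF finE] pairs_extend_of_equistarable
    by blast
qed

end
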